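(* Let $\mathbf{A}=\langle A,\vee,1\rangle$ be a distributive nearlattice. Then the following are equivalent: (1) $\mathbf{A}$ is quasicomplemented; (2) for each $a\in A$ there exists $b\in A$ such that $\psi[a^{\top\top}]\cap \mathrm{X}_m(A)=\psi[b^{\top}]\cap\mathrm{X}_m(A)$.
   Context: A distributive nearlattice is a join-semilattice $\langle A,\vee,1\rangle$ with greatest element $1$ in which every principal filter $[a)=\{x\in A\colon a\le x\}$ is a bounded distributive lattice. An ideal of $A$ is a subset $I$ that is downward closed and closed under $\vee$. A prime ideal is a non-empty proper ideal $P$ such that $a\wedge b\in P$ implies $a\in P$ or $b\in P$ whenever $a\wedge b$ exists; $\mathrm{X}(A)$ denotes the set of prime ideals. A maximal ideal is a non-empty proper ideal $I$ such that for every ideal $J\supseteq I$, $J=I$ or $J=A$; $\mathrm{X}_m(A)$ denotes the set of maximal ideals. For $Y\subseteq A$, $\psi[Y]=\{P\in\mathrm{X}(A)\colon Y\cap P\neq\emptyset\}$. For $a\in A$, $a^{\top}=\{x\in A\colon x\vee a=1\}$ and $a^{\top\top}=\{y\in A\colon y\vee x=1\text{ for all }x\in a^{\top}\}$. $\mathbf{A}$ is quasicomplemented if for each $a\in A$ there exists $b\in A$ with $a^{\top\top}=b^{\top}$. *)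

theory Defs
  imports "HOL-Algebra.Lattice"
begin

text \<open>Semilattices are carrier-based ordered structures: \<open>x \<squnion>\<^bsub>L\<^esub> y\<close> is the join and
  \<open>\<top>\<^bsub>L\<^esub>\<close> the greatest element \<open>1\<close>.\<close>

locale bounded_distributive_lattice = bounded_lattice L for L (structure) +
  assumes meet_join_distrib:
    "\<lbrakk>x \<in> carrier L; y \<in> carrier L; z \<in> carrier L\<rbrakk>
      \<Longrightarrow> x \<sqinter> (y \<squnion> z) = (x \<sqinter> y) \<squnion> (x \<sqinter> z)"

definition principal_filter :: "('a, 'b) gorder_scheme \<Rightarrow> 'a \<Rightarrow> 'a set" where
  "principal_filter L a = {x \<in> carrier L. a \<sqsubseteq>\<^bsub>L\<^esub> x}"

locale distributive_nearlattice =
  upper_semilattice L + weak_partial_order_top L for L (structure) +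
  assumes principal_filter_lattice:
    "a \<in> carrier L \<Longrightarrow> bounded_distributive_lattice (L\<lparr>carrier := principal_filter L a\<rparr>)"

text \<open>The empty set counts as an ideal; prime and maximal ideals are required to be non-empty.\<close>

definition nl_ideal :: "('a, 'b) gorder_scheme \<Rightarrow> 'a set \<Rightarrow> bool" where
  "nl_ideal L I \<longleftrightarrow> I \<subseteq> carrier L
     \<and> (\<forall>x\<in>carrier L. \<forall>y\<in>I. x \<sqsubseteq>\<^bsub>L\<^esub> y \<longrightarrow> x \<in> I)
     \<and> (\<forall>x\<in>I. \<forall>y\<in>I. x \<squnion>\<^bsub>L\<^esub> y \<in> I)"

text \<open>Meets are partial in a nearlattice, so ``\<open>a \<and> b\<close> exists and lies in \<open>P\<close>'' is stated via
  \<^const>\<open>is_glb\<close>.\<close>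

definition prime_ideals :: "('a, 'b) gorder_scheme \<Rightarrow> 'a set set" where
  "prime_ideals L = {P. nl_ideal L P \<and> P \<noteq> {} \<and> P \<noteq> carrier L
     \<and> (\<forall>a\<in>carrier L. \<forall>b\<in>carrier L. \<forall>m.
          is_glb L m {a, b} \<and> m \<in> P \<longrightarrow> a \<in> P \<or> b \<in> P)}"

definition maximal_ideals :: "('a, 'b) gorder_scheme \<Rightarrow> 'a set set" where
  "maximal_ideals L = {I. nl_ideal L I \<and> I \<noteq> {} \<and> I \<noteq> carrier L
     \<and> (\<forall>J. nl_ideal L J \<and> I \<subseteq> J \<longrightarrow> J = I \<or> J = carrier L)}"

definition psi :: "('a, 'b) gorder_scheme \<Rightarrow> 'a set \<Rightarrow> 'a set set" where
  "psi L Y = {P \<in> prime_ideals L. Y \<inter> P \<noteq> {}}"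

definition top_annihilator :: "('a, 'b) gorder_scheme \<Rightarrow> 'a \<Rightarrow> 'a set" where
  "top_annihilator L a = {x \<in> carrier L. x \<squnion>\<^bsub>L\<^esub> a = \<top>\<^bsub>L\<^esub>}"

definition top_biannihilator :: "('a, 'b) gorder_scheme \<Rightarrow> 'a \<Rightarrow> 'a set" where
  "top_biannihilator L a =
     {y \<in> carrier L. \<forall>x\<in>top_annihilator L a. y \<squnion>\<^bsub>L\<^esub> x = \<top>\<^bsub>L\<^esub>}"

definition quasicomplemented :: "('a, 'b) gorder_scheme \<Rightarrow> bool" where
  "quasicomplemented L \<longleftrightarrow>
     (\<forall>a\<in>carrier L. \<exists>b\<in>carrier L. top_biannihilator L a = top_annihilator L b)"

end

theory Submission
  imports Defs
begin

text \<open>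
  By Zorn's lemma, two elements join to \<open>1\<close> iff no maximal ideal contains both. Let
  \<open>Z\<^sup>\<top> = {x. x \<or> z = 1 for all z \<in> Z}\<close>. If \<open>x \<in> X\<close> and \<open>z \<in> Z\<close> do not join to \<open>1\<close>, a maximal ideal
  containing both meets \<open>X\<close> but not \<open>Z\<^sup>\<top>\<close>, since it contains \<open>z\<close>. Hence maximal ideals detect the
  inclusion \<open>X \<subseteq> Z\<^sup>\<top>\<close>, and in particular the equality of \<open>a\<^sup>\<top>\<^sup>\<top> = (a\<^sup>\<top>)\<^sup>\<top>\<close> and \<open>b\<^sup>\<top> = {b}\<^sup>\<top>\<close>.
  Distributivity of the principal filters is needed only for maximal ideals to be prime, so that
  \<open>\<psi>\<close> sees all of them.
\<close>

lemma (in bounded_distributive_lattice) le_if_meet_le_and_le_join: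
  assumes carr: "a \<in> carrier L" "b \<in> carrier L" "c \<in> carrier L"
    and meet: "b \<sqinter> a \<sqsubseteq> c" and join: "b \<sqsubseteq> a \<squnion> c"
  shows "b \<sqsubseteq> c"
proof -
  have "b \<sqsubseteq> b \<sqinter> (a \<squnion> c)"
    using carr join by (simp add: meet_le)
  also have "b \<sqinter> (a \<squnion> c) = (b \<sqinter> a) \<squnion> (b \<sqinter> c)"
    using carr by (simp add: meet_join_distrib)
  also have "\<dots> \<sqsubseteq> c"
    using carr meet by (simp add: join_le meet_right)
  finally show ?thesis
    using carr by simp
qed

lemma (in upper_semilattice) join_mono:
  assumes "x \<sqsubseteq> x'" "y \<sqsubseteq> y'"
    and "x \<in> carrier L" "x' \<in> carrier L" "y \<in> carrier L" "y' \<in> carrier L"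
  shows "x \<squnion> y \<sqsubseteq> x' \<squnion> y'"
  using assms by (meson join_le join_left join_right join_closed le_trans)


section \<open>Ideals\<close>

lemma nl_ideal_subset: "nl_ideal L I \<Longrightarrow> I \<subseteq> carrier L"
  unfolding nl_ideal_def by blast

lemma nl_ideal_downD:
  "\<lbrakk>nl_ideal L I; y \<in> I; x \<in> carrier L; x \<sqsubseteq>\<^bsub>L\<^esub> y\<rbrakk> \<Longrightarrow> x \<in> I"
  unfolding nl_ideal_def by blast

lemma nl_ideal_joinD:
  "\<lbrakk>nl_ideal L I; x \<in> I; y \<in> I\<rbrakk> \<Longrightarrow> x \<squnion>\<^bsub>L\<^esub> y \<in> I"
  unfolding nl_ideal_def by blast

lemma maximal_ideals_nl_ideal: "M \<in> maximal_ideals L \<Longrightarrow> nl_ideal L M"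
  unfolding maximal_ideals_def by blast

lemma nl_ideal_Union_chain:
  assumes ideal: "\<And>I. I \<in> C \<Longrightarrow> nl_ideal L I"
    and chain: "\<And>I J. I \<in> C \<Longrightarrow> J \<in> C \<Longrightarrow> I \<subseteq> J \<or> J \<subseteq> I"
  shows "nl_ideal L (\<Union>C)"
  unfolding nl_ideal_def
proof (intro conjI ballI impI)
  show "\<Union>C \<subseteq> carrier L"
    using ideal [THEN nl_ideal_subset] by blast
next
  fix x y
  assume "x \<in> carrier L" "y \<in> \<Union>C" "x \<sqsubseteq>\<^bsub>L\<^esub> y"
  then show "x \<in> \<Union>C"
    using ideal [THEN nl_ideal_downD] by blast
next
  fix x y
  assume "x \<in> \<Union>C" "y \<in> \<Union>C"
  then obtain I where "I \<in> C" "x \<in> I" "y \<in> I"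
    using chain by blast
  then show "x \<squnion>\<^bsub>L\<^esub> y \<in> \<Union>C"
    using ideal [THEN nl_ideal_joinD] by blast
qed

definition down_closure :: "('a, 'b) gorder_scheme \<Rightarrow> 'a set \<Rightarrow> 'a set" where
  "down_closure L S = {x \<in> carrier L. \<exists>s\<in>S. x \<sqsubseteq>\<^bsub>L\<^esub> s}"

lemma (in upper_semilattice) nl_ideal_down_closure:
  assumes S: "S \<subseteq> carrier L"
    and directed: "\<And>s t. \<lbrakk>s \<in> S; t \<in> S\<rbrakk> \<Longrightarrow> \<exists>u\<in>S. s \<sqsubseteq> u \<and> t \<sqsubseteq> u"
  shows "nl_ideal L (down_closure L S)"
  unfolding nl_ideal_def
proof (intro conjI ballI impI)
  show "down_closure L S \<subseteq> carrier L"
    by (auto simp: down_closure_def)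
next
  fix x y
  assume "x \<in> carrier L" "y \<in> down_closure L S" "x \<sqsubseteq> y"
  then show "x \<in> down_closure L S"
    using S unfolding down_closure_def by (blast intro: le_trans)
next
  fix x y
  assume "x \<in> down_closure L S" "y \<in> down_closure L S"
  then obtain s t where x: "x \<in> carrier L" "s \<in> S" "x \<sqsubseteq> s"
    and y: "y \<in> carrier L" "t \<in> S" "y \<sqsubseteq> t"
    by (auto simp: down_closure_def)
  then obtain u where u: "u \<in> S" "s \<sqsubseteq> u" "t \<sqsubseteq> u"
    using directed by blast
  have "x \<sqsubseteq> u" "y \<sqsubseteq> u"
    using x y u S by (blast intro: le_trans)+
  then show "x \<squnion> y \<in> down_closure L S"
    using x y u(1) S unfolding down_closure_def by (blast intro: join_le join_closed)
qed

lemma (in upper_semilattice) nl_ideal_down_closure_join_image: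
  assumes I: "nl_ideal L I" and a: "a \<in> carrier L"
  shows "nl_ideal L (down_closure L ((\<lambda>i. i \<squnion> a) ` I))"
proof (rule nl_ideal_down_closure)
  show "(\<lambda>i. i \<squnion> a) ` I \<subseteq> carrier L"
    using nl_ideal_subset [OF I] a by auto
next
  fix s t
  assume "s \<in> (\<lambda>i. i \<squnion> a) ` I" "t \<in> (\<lambda>i. i \<squnion> a) ` I"
  then obtain i j where ij: "i \<in> I" "j \<in> I" and st: "s = i \<squnion> a" "t = j \<squnion> a"
    by blast
  then have carr: "i \<in> carrier L" "j \<in> carrier L"
    using nl_ideal_subset [OF I] by auto
  then have "s \<sqsubseteq> (i \<squnion> j) \<squnion> a" "t \<sqsubseteq> (i \<squnion> j) \<squnion> a"
    unfolding st using a by (simp_all add: join_mono join_left join_right)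
  then show "\<exists>u\<in>(\<lambda>i. i \<squnion> a) ` I. s \<sqsubseteq> u \<and> t \<sqsubseteq> u"
    using nl_ideal_joinD [OF I ij] by blast
qed


section \<open>Maximal ideals and annihilators\<close>

locale upper_semilattice_top = upper_semilattice L + weak_partial_order_top L for L (structure)
begin

lemma top_unique: "\<lbrakk>x \<in> carrier L; \<top> \<sqsubseteq> x\<rbrakk> \<Longrightarrow> x = \<top>"
  by (auto intro: le_antisym)

lemma nl_ideal_eq_carrier_iff:
  assumes "nl_ideal L I"
  shows "I = carrier L \<longleftrightarrow> \<top> \<in> I"
  using nl_ideal_subset [OF assms] nl_ideal_downD [OF assms] by auto

lemma top_notin_maximal_ideal: "M \<in> maximal_ideals L \<Longrightarrow> \<top> \<notin> M"
  using nl_ideal_eq_carrier_iff unfolding maximal_ideals_def by blast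

lemma exists_maximal_ideal_superset:
  assumes I: "nl_ideal L I" "I \<noteq> {}" "\<top> \<notin> I"
  obtains M where "M \<in> maximal_ideals L" "I \<subseteq> M"
proof -
  let ?P = "{J. nl_ideal L J \<and> I \<subseteq> J \<and> \<top> \<notin> J}"
  have "\<exists>M\<in>?P. \<forall>J\<in>?P. M \<subseteq> J \<longrightarrow> J = M"
  proof (rule subset_Zorn_nonempty)
    show "?P \<noteq> {}"
      using I by blast
  next
    fix C
    assume "C \<noteq> {}" and "subset.chain ?P C"
    then have P: "C \<subseteq> ?P" and chain: "\<And>I J. I \<in> C \<Longrightarrow> J \<in> C \<Longrightarrow> I \<subseteq> J \<or> J \<subseteq> I"
      by (auto simp: subset_chain_def)
    have "nl_ideal L (\<Union>C)"
      using P chain by (intro nl_ideal_Union_chain) auto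
    then show "\<Union>C \<in> ?P"
      using P \<open>C \<noteq> {}\<close> by blast
  qed
  then obtain M where M: "nl_ideal L M" "I \<subseteq> M" "\<top> \<notin> M"
    and max: "\<And>J. \<lbrakk>nl_ideal L J; I \<subseteq> J; \<top> \<notin> J; M \<subseteq> J\<rbrakk> \<Longrightarrow> J = M"
    by auto
  have "J = M \<or> J = carrier L" if "nl_ideal L J" "M \<subseteq> J" for J
    using that M max [of J] nl_ideal_eq_carrier_iff by blast
  then have "M \<in> maximal_ideals L"
    using M I nl_ideal_eq_carrier_iff [OF M(1)] unfolding maximal_ideals_def by blast
  then show thesis
    using M that by blast
qed

lemma exists_maximal_ideal_containing:
  assumes c: "c \<in> carrier L" "c \<noteq> \<top>"
  obtains M where "M \<in> maximal_ideals L" "c \<in> M"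
proof -
  let ?I = "down_closure L {c}"
  have "nl_ideal L ?I"
    using c by (intro nl_ideal_down_closure) auto
  moreover have "c \<in> ?I"
    using c by (simp add: down_closure_def)
  moreover have "\<top> \<notin> ?I"
    using c top_unique by (auto simp: down_closure_def)
  ultimately obtain M where "M \<in> maximal_ideals L" "?I \<subseteq> M"
    using exists_maximal_ideal_superset [of ?I] by blast
  then show thesis
    using \<open>c \<in> ?I\<close> that by blast
qed

lemma join_eq_top_iff:
  assumes x: "x \<in> carrier L" and y: "y \<in> carrier L"
  shows "x \<squnion> y = \<top> \<longleftrightarrow> (\<forall>M\<in>maximal_ideals L. \<not> (x \<in> M \<and> y \<in> M))"
proof (intro iffI ballI notI)
  fix M
  assume "x \<squnion> y = \<top>" and M: "M \<in> maximal_ideals L" and "x \<in> M \<and> y \<in> M"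
  then show False
    using nl_ideal_joinD [OF maximal_ideals_nl_ideal [OF M]] top_notin_maximal_ideal [OF M] by metis
next
  assume none: "\<forall>M\<in>maximal_ideals L. \<not> (x \<in> M \<and> y \<in> M)"
  show "x \<squnion> y = \<top>"
  proof (rule ccontr)
    assume "x \<squnion> y \<noteq> \<top>"
    then obtain M where M: "M \<in> maximal_ideals L" "x \<squnion> y \<in> M"
      using exists_maximal_ideal_containing [OF join_closed [OF x y]] by blast
    then have "x \<in> M" "y \<in> M"
      using x y nl_ideal_downD [OF maximal_ideals_nl_ideal [OF M(1)] M(2)] join_left join_right
      by blast+
    then show False
      using none M by blast
  qed
qed

lemma maximal_ideal_join_eq_topE:
  assumes M: "M \<in> maximal_ideals L" and a: "a \<in> carrier L" "a \<notin> M"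
  obtains i where "i \<in> M" "a \<squnion> i = \<top>"
proof -
  have I: "nl_ideal L M" and "M \<noteq> {}"
    and max: "\<And>J. \<lbrakk>nl_ideal L J; M \<subseteq> J\<rbrakk> \<Longrightarrow> J = M \<or> J = carrier L"
    using M unfolding maximal_ideals_def by auto
  have carr: "i \<in> carrier L" if "i \<in> M" for i
    using that nl_ideal_subset [OF I] by blast
  let ?J = "down_closure L ((\<lambda>i. i \<squnion> a) ` M)"
  have "M \<subseteq> ?J" "a \<in> ?J"
    using carr a(1) \<open>M \<noteq> {}\<close> unfolding down_closure_def
    by (blast intro: join_left join_right)+
  then have "?J = carrier L"
    using max [OF nl_ideal_down_closure_join_image [OF I a(1)]] a by blast
  then obtain i where i: "i \<in> M" "\<top> \<sqsubseteq> i \<squnion> a"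
    using top_closed unfolding down_closure_def by blast
  then have "a \<squnion> i = \<top>"
    using carr a by (metis top_unique join_closed join_comm)
  then show thesis
    using i that by blast
qed

end

definition top_annihilator_set :: "('a, 'b) gorder_scheme \<Rightarrow> 'a set \<Rightarrow> 'a set" where
  "top_annihilator_set L Z = {x \<in> carrier L. \<forall>z\<in>Z. x \<squnion>\<^bsub>L\<^esub> z = \<top>\<^bsub>L\<^esub>}"

lemma top_annihilator_eq_top_annihilator_set:
  "top_annihilator L a = top_annihilator_set L {a}"
  by (simp add: top_annihilator_def top_annihilator_set_def)

lemma top_biannihilator_eq_top_annihilator_set:
  "top_biannihilator L a = top_annihilator_set L (top_annihilator L a)"
  by (simp add: top_biannihilator_def top_annihilator_set_def)

lemma (in upper_semilattice_top) subset_top_annihilator_set_iff: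
  assumes X: "X \<subseteq> carrier L" and Z: "Z \<subseteq> carrier L"
  shows "X \<subseteq> top_annihilator_set L Z \<longleftrightarrow>
    (\<forall>M\<in>maximal_ideals L. X \<inter> M \<noteq> {} \<longrightarrow> top_annihilator_set L Z \<inter> M \<noteq> {})"
proof
  assume meets: "\<forall>M\<in>maximal_ideals L. X \<inter> M \<noteq> {} \<longrightarrow> top_annihilator_set L Z \<inter> M \<noteq> {}"
  have "x \<squnion> z = \<top>" if "x \<in> X" "z \<in> Z" for x z
  proof -
    have carr: "x \<in> carrier L" "z \<in> carrier L"
      using that X Z by auto
    have False if M: "M \<in> maximal_ideals L" "x \<in> M" "z \<in> M" for M
    proof -
      obtain w where "w \<in> top_annihilator_set L Z" "w \<in> M"
        using meets M \<open>x \<in> X\<close> by blast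
      then have "w \<in> carrier L" "w \<squnion> z = \<top>"
        using \<open>z \<in> Z\<close> by (auto simp: top_annihilator_set_def)
      then show False
        using join_eq_top_iff [OF _ carr(2)] M \<open>w \<in> M\<close> by blast
    qed
    then show ?thesis
      using join_eq_top_iff [OF carr] by blast
  qed
  then show "X \<subseteq> top_annihilator_set L Z"
    using X by (auto simp: top_annihilator_set_def)
qed blast


section \<open>Maximal ideals of distributive nearlattices\<close>

context distributive_nearlattice
begin

sublocale upper_semilattice_top
  by unfold_locales

lemma join_principal_filter:
  assumes m: "m \<in> carrier L" and x: "x \<in> principal_filter L m" and y: "y \<in> principal_filter L m"
  shows "x \<squnion>\<^bsub>L\<lparr>carrier := principal_filter L m\<rparr>\<^esub> y = x \<squnion> y"
proof -
  let ?F = "L\<lparr>carrier := principal_filter L m\<rparr>"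
  interpret F: bounded_distributive_lattice ?F
    using m by (rule principal_filter_lattice)
  have carr: "x \<in> carrier L" "y \<in> carrier L"
    using x y by (simp_all add: principal_filter_def)
  have join: "x \<squnion> y \<in> principal_filter L m"
    using m x carr by (auto simp: principal_filter_def intro: le_trans join_left)
  show ?thesis
  proof (rule le_antisym)
    show "x \<squnion>\<^bsub>?F\<^esub> y \<sqsubseteq> x \<squnion> y"
      using F.join_le [of x "x \<squnion> y" y] x y carr join by (simp add: join_left join_right)
    show "x \<squnion> y \<sqsubseteq> x \<squnion>\<^bsub>?F\<^esub> y"
      using F.join_left [of x y] F.join_right [of x y] F.join_closed [of x y] x y carr
      by (simp add: join_le principal_filter_def)
  qed (use x y carr F.join_closed [of x y] in \<open>simp_all add: principal_filter_def\<close>)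
qed

lemma le_if_is_glb_le_and_le_join:
  assumes carr: "a \<in> carrier L" "b \<in> carrier L" "c \<in> carrier L"
    and m: "is_glb L m {a, b}" and mc: "m \<sqsubseteq> c" and join: "b \<sqsubseteq> a \<squnion> c"
  shows "b \<sqsubseteq> c"
proof -
  have mL: "m \<in> carrier L" and lower: "m \<sqsubseteq> a" "m \<sqsubseteq> b"
    and glb: "\<And>z. \<lbrakk>z \<in> carrier L; z \<sqsubseteq> a; z \<sqsubseteq> b\<rbrakk> \<Longrightarrow> z \<sqsubseteq> m"
    using m carr unfolding greatest_def Lower_def by auto
  let ?F = "L\<lparr>carrier := principal_filter L m\<rparr>"
  interpret F: bounded_distributive_lattice ?F
    using mL by (rule principal_filter_lattice)
  have abc: "a \<in> principal_filter L m" "b \<in> principal_filter L m" "c \<in> principal_filter L m"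
    using carr lower mc by (simp_all add: principal_filter_def)
  have meet: "b \<sqinter>\<^bsub>?F\<^esub> a \<in> carrier L"
    using F.meet_closed [of b a] abc by (simp add: principal_filter_def)
  then have "b \<sqinter>\<^bsub>?F\<^esub> a \<sqsubseteq> m"
    using F.meet_left [of b a] F.meet_right [of b a] abc by (intro glb) simp_all
  then have "b \<sqinter>\<^bsub>?F\<^esub> a \<sqsubseteq> c"
    using meet mL mc carr by (blast intro: le_trans)
  moreover have "b \<sqsubseteq> a \<squnion>\<^bsub>?F\<^esub> c"
    using join_principal_filter [OF mL] abc join by simp
  ultimately show ?thesis
    using F.le_if_meet_le_and_le_join [of a b c] abc by simp
qed

lemma maximal_ideals_subset_prime_ideals: "maximal_ideals L \<subseteq> prime_ideals L"
proof
  fix M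
  assume M: "M \<in> maximal_ideals L"
  note I = maximal_ideals_nl_ideal [OF M]
  have "b \<in> M"
    if carr: "a \<in> carrier L" "b \<in> carrier L" and m: "is_glb L m {a, b}" "m \<in> M"
      and a: "a \<notin> M" for a b m
  proof -
    obtain i where i: "i \<in> M" "a \<squnion> i = \<top>"
      using maximal_ideal_join_eq_topE [OF M carr(1) a] .
    have im: "i \<in> carrier L" "m \<in> carrier L"
      using i m nl_ideal_subset [OF I] by auto
    have "\<top> \<sqsubseteq> a \<squnion> (i \<squnion> m)"
      using i(2) join_mono [of a a i "i \<squnion> m"] carr im by (simp add: join_left)
    then have "b \<sqsubseteq> a \<squnion> (i \<squnion> m)"
      using carr im top_unique by (metis join_closed top_higher)
    then have "b \<sqsubseteq> i \<squnion> m"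
      using le_if_is_glb_le_and_le_join [OF carr _ m(1)] im by (simp add: join_right)
    then show ?thesis
      using nl_ideal_downD [OF I nl_ideal_joinD [OF I i(1) m(2)]] carr by blast
  qed
  then show "M \<in> prime_ideals L"
    using M unfolding prime_ideals_def maximal_ideals_def by blast
qed

lemma psi_Int_maximal_ideals:
  "psi L Y \<inter> maximal_ideals L = {M \<in> maximal_ideals L. Y \<inter> M \<noteq> {}}"
  using maximal_ideals_subset_prime_ideals unfolding psi_def by blast

lemma top_annihilator_set_subset_iff_psi_subset:
  assumes X: "X \<subseteq> carrier L" and Z: "Z \<subseteq> carrier L"
  shows "X \<subseteq> top_annihilator_set L Z \<longleftrightarrow>
    psi L X \<inter> maximal_ideals L \<subseteq> psi L (top_annihilator_set L Z) \<inter> maximal_ideals L"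
  unfolding psi_Int_maximal_ideals subset_top_annihilator_set_iff [OF X Z] by blast

lemma top_annihilator_set_eq_iff_psi_eq:
  assumes "Y \<subseteq> carrier L" "Z \<subseteq> carrier L"
  shows "top_annihilator_set L Y = top_annihilator_set L Z \<longleftrightarrow>
    psi L (top_annihilator_set L Y) \<inter> maximal_ideals L
      = psi L (top_annihilator_set L Z) \<inter> maximal_ideals L"
proof -
  have "top_annihilator_set L W \<subseteq> carrier L" for W
    by (auto simp: top_annihilator_set_def)
  then show ?thesis
    using assms by (simp only: set_eq_subset top_annihilator_set_subset_iff_psi_subset)
qed

end

theorem theorem3p5:
  fixes A :: "('a, 'b) gorder_scheme"
  assumes "distributive_nearlattice A"
  shows "quasicomplemented A \<longleftrightarrow>
    (\<forall>a\<in>carrier A. \<exists>b\<in>carrier A.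
       psi A (top_biannihilator A a) \<inter> maximal_ideals A
         = psi A (top_annihilator A b) \<inter> maximal_ideals A)"
proof -
  interpret distributive_nearlattice A by fact
  have "top_biannihilator A a = top_annihilator A b \<longleftrightarrow>
      psi A (top_biannihilator A a) \<inter> maximal_ideals A
        = psi A (top_annihilator A b) \<inter> maximal_ideals A"
    if "b \<in> carrier A" for a b
  proof -
    have "top_annihilator A a \<subseteq> carrier A" "{b} \<subseteq> carrier A"
      using that by (auto simp: top_annihilator_def)
    then show ?thesis
      unfolding top_biannihilator_eq_top_annihilator_set
        top_annihilator_eq_top_annihilator_set [of A b]
      by (rule top_annihilator_set_eq_iff_psi_eq)
  qed
  then show ?thesis
    by (simp add: quasicomplemented_def)
qed

end
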